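(* Let $k$ be a positive integer and let $G$ be a connected, triangle-free graph of order $n$ with minimum degree $\delta$. Then $G$ contains a spanning tree $T$ with $$SW_k(T) \leq \frac{k-1}{k+1}\,\frac{2(n+1)}{\delta}\binom{n}{k} + \Big(\frac{4\delta-2}{\delta}+3k+1\Big)\binom{n}{k}.$$
   Context: All graphs are finite and simple; the order of a graph is its number of vertices. For a non-empty set $S$ of vertices of a connected graph $G$, the Steiner distance $d_G(S)$ is the minimum size (number of edges) of a connected subgraph of $G$ containing all vertices of $S$. For a positive integer $k$, the Steiner $k$-Wiener index of a connected graph $G$ is $SW_k(G)=\sum_{S\subseteq V(G),\,|S|=k} d_G(S)$. For the spanning tree $T$, the Steiner distances in $SW_k(T)$ are taken in $T$. *)

theory Defs
  imports Complex_Main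
begin

(* Undirected graphs with edges as two-element sets.  The AFP entry Graph_Theory is not used:
   its "tree" only forbids directed cycles, and in a symmetric digraph every edge is
   itself a directed cycle of length two. *)

record 'a sgraph =
  verts :: "'a set"
  edges :: "'a set set"

definition simple_graph :: "'a sgraph \<Rightarrow> bool" where
  "simple_graph G \<longleftrightarrow>
     finite (verts G) \<and> (\<forall>e\<in>edges G. e \<subseteq> verts G \<and> card e = 2)"

definition subgraph :: "'a sgraph \<Rightarrow> 'a sgraph \<Rightarrow> bool" where
  "subgraph H G \<longleftrightarrow> simple_graph H \<and> verts H \<subseteq> verts G \<and> edges H \<subseteq> edges G"

definition walk :: "'a sgraph \<Rightarrow> 'a list \<Rightarrow> bool" where
  "walk G xs \<longleftrightarrow>
     xs \<noteq> [] \<and> set xs \<subseteq> verts G \<and> successively (\<lambda>u v. {u, v} \<in> edges G) xs"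

(* The null graph does not count as connected. *)
definition connected_graph :: "'a sgraph \<Rightarrow> bool" where
  "connected_graph G \<longleftrightarrow>
     verts G \<noteq> {} \<and>
     (\<forall>u\<in>verts G. \<forall>v\<in>verts G. \<exists>xs. walk G xs \<and> hd xs = u \<and> last xs = v)"

(* A cycle is given by its distinct vertices in cyclic order. *)
definition cycle :: "'a sgraph \<Rightarrow> 'a list \<Rightarrow> bool" where
  "cycle G xs \<longleftrightarrow>
     walk G xs \<and> distinct xs \<and> length xs \<ge> 3 \<and> {last xs, hd xs} \<in> edges G"

definition tree :: "'a sgraph \<Rightarrow> bool" where
  "tree T \<longleftrightarrow> simple_graph T \<and> connected_graph T \<and> (\<nexists>xs. cycle T xs)"

definition spanning_tree :: "'a sgraph \<Rightarrow> 'a sgraph \<Rightarrow> bool" where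
  "spanning_tree T G \<longleftrightarrow> tree T \<and> subgraph T G \<and> verts T = verts G"

(* In a simple graph the three vertices are automatically distinct. *)
definition triangle_free :: "'a sgraph \<Rightarrow> bool" where
  "triangle_free G \<longleftrightarrow>
     \<not> (\<exists>u v w. {u, v} \<in> edges G \<and> {v, w} \<in> edges G \<and> {u, w} \<in> edges G)"

definition degree :: "'a sgraph \<Rightarrow> 'a \<Rightarrow> nat" where
  "degree G v = card {e \<in> edges G. v \<in> e}"

definition min_degree :: "'a sgraph \<Rightarrow> nat" where
  "min_degree G = Min (degree G ` verts G)"

(* Meaningful for a connected simple graph G and S contained in verts G, where G itself is a
   candidate for H. *)
definition steiner_dist :: "'a sgraph \<Rightarrow> 'a set \<Rightarrow> nat" where
  "steiner_dist G S =
     (LEAST m. \<exists>H. subgraph H G \<and> connected_graph H \<and> S \<subseteq> verts H \<and> card (edges H) = m)"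

definition steiner_wiener :: "nat \<Rightarrow> 'a sgraph \<Rightarrow> nat" where
  "steiner_wiener k G = (\<Sum>S | S \<subseteq> verts G \<and> card S = k. steiner_dist G S)"

end

theory Submission
  imports Defs
begin

text \<open>Choose edges \<open>x\<^sub>i y\<^sub>i\<close> one after the other such that the neighbourhood of each pair of ends (a double
  star, called a cluster) is disjoint from the earlier clusters and joined to one of them by an edge.
  As \<open>G\<close> has no triangles, a cluster has at least \<open>2 * \<delta>\<close> vertices. If no further edge can be chosen,
  every vertex has distance at most two from some cluster. The clusters, the edges joining them, and
  shortest paths from the other vertices to the clusters form the spanning tree \<open>T\<close>.

  Contracting the clusters gives a tree \<open>H\<close>; every vertex of \<open>G\<close> is assigned to the cluster at which
  its path to the clusters ends, which puts at least \<open>D = 2 * \<delta>\<close> vertices on each vertex of \<open>H\<close>. If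
  the smallest subtree of \<open>H\<close> that spans the clusters of a \<open>k\<close>-set \<open>S\<close> has \<open>q\<close> edges, then \<open>S\<close> lies in a
  subtree of \<open>T\<close> with at most \<open>4 * (q + 1) + 3 * k - 2\<close> vertices: each of the \<open>q\<close> edges becomes a path with
  three edges, each of the \<open>q + 1\<close> clusters contributes its central edge, and each element of \<open>S\<close> is at
  distance at most three from a centre (\<open>steiner_dist_cluster_tree_le\<close>). Hence
  \<open>d\<^sub>T(S) \<le> 4 * q + 1 + 3 * k\<close>.

  It remains to sum \<open>q\<close> over all \<open>k\<close>-sets, edge by edge of \<open>H\<close>. An edge with \<open>a\<close> of the \<open>n\<close> vertices on
  one side is counted for \<open>split_count n k a\<close> sets, a number that increases with the smaller side. At
  most \<open>(n - 2 * t) / D + 1\<close> edges have at least \<open>t\<close> vertices on both sides, because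
  contracting all other edges leaves a tree whose leaves carry at least \<open>t\<close> vertices each, and whose
  other vertices at least \<open>D\<close> (\<open>card_heavy_edges\<close>). In a path on \<open>n\<close> vertices there
  are exactly \<open>n - 2 * t + 1\<close> such edges, and its Steiner index is
  \<open>(k - 1) / (k + 1) * (n + 1)\<close> times \<open>n choose k\<close>. Summation by parts therefore bounds the sum of \<open>q\<close> by
  \<open>1 / D\<close> times the index of the path plus \<open>1 - 1 / D\<close> times \<open>n choose k\<close>
  (\<open>sum_split_count_branches_le\<close>), and four times this is the claimed bound without its summand
  \<open>(3 * k + 1) * (n choose k)\<close>.\<close>

section \<open>Trees given by a parent map\<close>

definition parent_graph :: "('a \<Rightarrow> 'a) \<Rightarrow> 'a \<Rightarrow> 'a set \<Rightarrow> 'a sgraph" where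
  "parent_graph p r W = \<lparr>verts = W, edges = (\<lambda>v. {v, p v}) ` (W - {r})\<rparr>"

lemma verts_parent_graph [simp]: "verts (parent_graph p r W) = W"
  by (simp add: parent_graph_def)

lemma edges_parent_graph: "edges (parent_graph p r W) = (\<lambda>v. {v, p v}) ` (W - {r})"
  by (simp add: parent_graph_def)

lemma walk_Cons:
  assumes "walk H xs" "u \<in> verts H" "{u, hd xs} \<in> edges H"
  shows "walk H (u # xs)"
  using assms unfolding walk_def by (cases xs) auto

lemma walk_snoc:
  assumes "walk H xs" "u \<in> verts H" "{last xs, u} \<in> edges H"
  shows "walk H (xs @ [u])"
  using assms unfolding walk_def by (auto simp: successively_append_iff)

lemma simple_parent_graph:
  assumes "finite W"
    and "\<And>v. v \<in> W \<Longrightarrow> v \<noteq> r \<Longrightarrow> p v \<in> W \<and> rk (p v) < (rk v :: nat)"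
  shows "simple_graph (parent_graph p r W)"
proof -
  have "{v, p v} \<subseteq> W \<and> card {v, p v} = 2" if "v \<in> W - {r}" for v
  proof -
    have "v \<noteq> p v" using assms(2)[of v] that by auto
    then show ?thesis using assms(2)[of v] that by auto
  qed
  then show ?thesis using assms(1) by (auto simp: simple_graph_def edges_parent_graph)
qed

lemma connected_parent_graph:
  assumes "r \<in> W"
    and step: "\<And>v. v \<in> W \<Longrightarrow> v \<noteq> r \<Longrightarrow> p v \<in> W \<and> rk (p v) < (rk v :: nat)"
  shows "connected_graph (parent_graph p r W)"
proof -
  let ?H = "parent_graph p r W"
  have "\<exists>xs. walk ?H xs \<and> hd xs = u \<and> last xs = v" if "u \<in> W" "v \<in> W" for u v
    using that
  proof (induction "rk u + rk v" arbitrary: u v rule: less_induct)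
    case less
    consider "u \<noteq> r" | "v \<noteq> r" | "u = r" "v = r" by blast
    then show ?case
    proof cases
      case 1
      have pu: "p u \<in> W" "rk (p u) < rk u" using step less.prems 1 by auto
      then obtain xs where xs: "walk ?H xs" "hd xs = p u" "last xs = v"
        using less.hyps[of "p u" v] less.prems by auto
      have "walk ?H (u # xs)"
        using xs less.prems 1 by (intro walk_Cons) (auto simp: edges_parent_graph)
      moreover have "last (u # xs) = v" using xs by (auto simp: walk_def)
      ultimately show ?thesis by (metis list.sel(1))
    next
      case 2
      have pv: "p v \<in> W" "rk (p v) < rk v" using step less.prems 2 by auto
      then obtain xs where xs: "walk ?H xs" "hd xs = u" "last xs = p v"
        using less.hyps[of u "p v"] less.prems by auto
      have "walk ?H (xs @ [v])"
        using xs less.prems 2 by (intro walk_snoc) (auto simp: edges_parent_graph insert_commute)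
      moreover have "hd (xs @ [v]) = u" using xs by (auto simp: walk_def)
      ultimately show ?thesis by (metis last_snoc)
    next
      case 3
      have "walk ?H [r]" using assms(1) by (simp add: walk_def)
      then show ?thesis using 3 by (metis last.simps list.sel(1))
    qed
  qed
  then show ?thesis using assms(1) by (auto simp: connected_graph_def)
qed

text \<open>On a cycle, a vertex of largest rank would have two distinct neighbours, both of which would
  have to be its parent.\<close>

lemma tree_parent_graph:
  assumes "finite W" "r \<in> W"
    and step: "\<And>v. v \<in> W \<Longrightarrow> v \<noteq> r \<Longrightarrow> p v \<in> W \<and> rk (p v) < (rk v :: nat)"
  shows "tree (parent_graph p r W)"
proof -
  let ?H = "parent_graph p r W"
  have "\<not> cycle ?H xs" for xs
  proof
    assume c: "cycle ?H xs"
    define L where "L = length xs"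
    have L: "L \<ge> 3" "distinct xs" using c by (auto simp: cycle_def L_def)
    have "0 < L" using L by simp
    then obtain i where i: "i < L" and imax: "\<And>j. j < L \<Longrightarrow> rk (xs ! j) \<le> rk (xs ! i)"
      using arg_max_nat_lemma[of "\<lambda>i. i < L" 0 "\<lambda>i. rk (xs ! i)" "Suc (Max ((\<lambda>i. rk (xs ! i)) ` {..<L}))"]
      by (auto simp: less_Suc_eq_le)
    have consec: "{xs ! j, xs ! Suc j} \<in> edges ?H" if "Suc j < L" for j
      using c that by (auto simp: cycle_def walk_def L_def successively_conv_nth)
    have wrap: "{xs ! (L - 1), xs ! 0} \<in> edges ?H"
      using c L by (auto simp: cycle_def walk_def L_def last_conv_nth hd_conv_nth)
    have nb: "xs ! j = p (xs ! i)" if j: "j < L" "{xs ! i, xs ! j} \<in> edges ?H" for j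
    proof -
      obtain v where v: "v \<in> W" "v \<noteq> r" "{xs ! i, xs ! j} = {v, p v}"
        using j(2) unfolding edges_parent_graph by blast
      then have "v = xs ! i \<and> p v = xs ! j \<or> v = xs ! j \<and> p v = xs ! i"
        by (auto simp: doubleton_eq_iff)
      then show ?thesis using step[of v] v imax[OF j(1)] by auto
    qed
    define s where "s = (if Suc i = L then 0 else Suc i)"
    define q where "q = (if i = 0 then L - 1 else i - 1)"
    have "s < L" "q < L" "s \<noteq> q" using L i by (auto simp: s_def q_def)
    moreover have "{xs ! i, xs ! s} \<in> edges ?H"
      using consec[of i] wrap i by (auto simp: s_def)
    moreover have "{xs ! i, xs ! q} \<in> edges ?H"
      using consec[of "i - 1"] wrap i by (auto simp: q_def insert_commute)
    ultimately show False using nb L(2) by (metis L_def nth_eq_iff_index_eq)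
  qed
  moreover have "simple_graph ?H" using assms(1) step by (rule simple_parent_graph)
  moreover have "connected_graph ?H" using assms(2) step by (rule connected_parent_graph)
  ultimately show ?thesis by (simp add: tree_def)
qed

lemma steiner_dist_le:
  assumes "subgraph H G" "connected_graph H" "S \<subseteq> verts H"
  shows "steiner_dist G S \<le> card (edges H)"
  unfolding steiner_dist_def using assms by (intro Least_le) blast

text \<open>Any set that contains \<open>S\<close> and is closed under taking parents, except at one vertex \<open>t\<close>, spans a
  subtree.\<close>

lemma steiner_dist_parent_graph_le:
  assumes "finite W" "t \<in> W" "W \<subseteq> V" "S \<subseteq> W" "r \<notin> W - {t}"
    and step: "\<And>v. v \<in> W \<Longrightarrow> v \<noteq> t \<Longrightarrow> p v \<in> W \<and> rk (p v) < (rk v :: nat)"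
  shows "steiner_dist (parent_graph p r V) S \<le> card W - 1"
proof -
  have "subgraph (parent_graph p t W) (parent_graph p r V)"
    unfolding subgraph_def using simple_parent_graph[of W t p rk] assms
    by (auto simp: edges_parent_graph)
  then have "steiner_dist (parent_graph p r V) S \<le> card (edges (parent_graph p t W))"
    using connected_parent_graph[of t W p rk] assms by (intro steiner_dist_le) auto
  also have "\<dots> \<le> card (W - {t})"
    unfolding edges_parent_graph using assms(1) by (intro card_image_le) auto
  finally show ?thesis using assms(1,2) by simp
qed

section \<open>Rooted trees on the natural numbers\<close>

text \<open>The root is \<open>0\<close>. Decreasing parents make induction on the vertices available, and the largest
  element of a finite set of vertices has no descendant in it.\<close>

locale rooted_nat =
  fixes par :: "nat \<Rightarrow> nat"
  assumes par_less: "0 < j \<Longrightarrow> par j < j"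
begin

definition up :: "nat \<Rightarrow> nat \<Rightarrow> bool" where
  "up = (\<lambda>j i. 0 < j \<and> i = par j)\<^sup>*\<^sup>*"

lemma up_refl [simp]: "up j j" by (simp add: up_def)

lemma up_trans: "up j i \<Longrightarrow> up i h \<Longrightarrow> up j h" by (simp add: up_def)

lemma up_par: "0 < j \<Longrightarrow> up j (par j)" unfolding up_def by (intro r_into_rtranclp) auto

lemma up_le: "up j i \<Longrightarrow> i \<le> j"
  unfolding up_def by (induction rule: rtranclp_induct) (auto dest: par_less)

lemma up_0: "up j 0"
proof (induction j rule: less_induct)
  case (less j)
  show ?case
    using less[of "par j"] par_less[of j] up_par[of j] up_trans[of j "par j" 0] by (cases "j = 0") auto
qed

lemma up_step: "up j i \<Longrightarrow> j \<noteq> i \<Longrightarrow> up (par j) i"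
  unfolding up_def by (erule converse_rtranclpE) auto

lemma up_linear: "up j i \<Longrightarrow> up j h \<Longrightarrow> up i h \<or> up h i"
proof (induction j rule: less_induct)
  case (less j)
  show ?case
  proof (cases "j = i \<or> j = h")
    case False
    then have "0 < j" using up_le[OF less.prems(1)] by auto
    then show ?thesis using less.IH[OF par_less] less.prems up_step False by blast
  qed (use less.prems in auto)
qed

end

section \<open>Heavy edges of a weighted tree\<close>

context rooted_nat
begin

text \<open>Think of a finite set \<open>V\<close> of points, the point \<open>v\<close> being placed at the vertex \<open>\<pi> v\<close> of the tree. The
  edge from \<open>i\<close> to its parent splits \<open>V\<close> into \<open>branch V \<pi> i\<close> and the rest.\<close>

definition branch :: "'a set \<Rightarrow> ('a \<Rightarrow> nat) \<Rightarrow> nat \<Rightarrow> 'a set" where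
  "branch V \<pi> i = {v \<in> V. up (\<pi> v) i}"

lemma branch_subset: "branch V \<pi> i \<subseteq> V"
  by (auto simp: branch_def)

end

lemma card_two_parts_and_fibres:
  assumes "finite V" "A \<subseteq> V" "B \<subseteq> V" "A \<inter> B = {}" "t \<le> card A" "t \<le> card B"
    and "finite J" "\<And>j. j \<in> J \<Longrightarrow> D \<le> card {v \<in> V. \<pi> v = j}"
    and "\<And>v. v \<in> V \<Longrightarrow> \<pi> v \<in> J \<Longrightarrow> v \<notin> A \<and> v \<notin> B"
  shows "2 * t + card J * D \<le> card V"
proof -
  let ?R = "\<Union>j\<in>J. {v \<in> V. \<pi> v = j}"
  have "card J * D = (\<Sum>j\<in>J. D)" by simp
  also have "\<dots> \<le> (\<Sum>j\<in>J. card {v \<in> V. \<pi> v = j})" using assms(8) by (intro sum_mono)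
  also have "\<dots> = card ?R" using assms(1,7) by (subst card_UN_disjoint) auto
  finally have "card J * D \<le> card ?R" .
  moreover have "card (A \<union> B \<union> ?R) = card A + card B + card ?R"
  proof -
    have "finite A" "finite B" "finite ?R"
      using assms(1-3,7) finite_subset by auto
    moreover have "(A \<union> B) \<inter> ?R = {}" using assms(9) by blast
    ultimately show ?thesis using assms(4) by (simp add: card_Un_disjoint)
  qed
  moreover have "card (A \<union> B \<union> ?R) \<le> card V" using assms(1-3) by (intro card_mono) auto
  ultimately show ?thesis using assms(5,6) by linarith
qed

context rooted_nat
begin

text \<open>Cutting the \<open>q = card F\<close> heavy edges leaves \<open>q + 1\<close> parts, each of weight at least \<open>D\<close>, and these
  form a tree in which every leaf has weight at least \<open>t\<close>; there are at least two leaves. One leaf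
  is the branch at the largest heavy \<open>i\<close>. The other one is the branch at the largest heavy index
  that is not above \<open>i\<close>, or, if all heavy indices lie above \<open>i\<close>, the complement of the largest
  branch. All other parts are only bounded by the weight of a single vertex.\<close>

lemma card_heavy_edges:
  fixes V :: "'a set" and \<pi> :: "'a \<Rightarrow> nat"
  defines "n \<equiv> card V"
  assumes "finite V" and "0 < m" and weight: "\<And>i. i < m \<Longrightarrow> D \<le> card {v \<in> V. \<pi> v = i}"
    and F: "F = {i. 0 < i \<and> i < m \<and> t \<le> card (branch V \<pi> i) \<and> t \<le> n - card (branch V \<pi> i)}"
    and "F \<noteq> {}"
  shows "2 * t + (card F - 1) * D \<le> n"
proof -
  have finF: "finite F" unfolding F by (rule finite_subset[of _ "{..<m}"]) auto
  define i where "i = Max F"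
  have i: "i \<in> F" "\<And>j. j \<in> F \<Longrightarrow> j \<le> i" using finF \<open>F \<noteq> {}\<close> by (auto simp: i_def)
  show ?thesis
  proof (cases "\<forall>j\<in>F. up i j")
    case True
    define h where "h = Min F"
    have h: "h \<in> F" "\<And>j. j \<in> F \<Longrightarrow> h \<le> j" using finF \<open>F \<noteq> {}\<close> by (auto simp: h_def)
    have above: "up j h" if "j \<in> F" for j
      using up_linear[of i j h] True that h up_le[of h j] by (metis le_antisym up_refl)
    have below: "\<not> up j i" if "j \<in> F - {i}" for j
      using up_le[of j i] i(2)[of j] that by auto
    have "card (V - branch V \<pi> h) = n - card (branch V \<pi> h)"
      using \<open>finite V\<close> branch_subset[of V \<pi> h] by (simp add: n_def card_Diff_subset finite_subset)
    note outside = this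
    have "2 * t + card (F - {i}) * D \<le> card V"
    proof (rule card_two_parts_and_fibres[where \<pi> = \<pi>])
      show "branch V \<pi> i \<inter> (V - branch V \<pi> h) = {}"
        using above[OF i(1)] by (auto simp: branch_def intro: up_trans)
      show "t \<le> card (V - branch V \<pi> h)" using outside h(1) by (simp add: F)
      show "v \<notin> branch V \<pi> i \<and> v \<notin> V - branch V \<pi> h" if "v \<in> V" "\<pi> v \<in> F - {i}" for v
        using above[of "\<pi> v"] below[of "\<pi> v"] that by (simp add: branch_def)
    qed (use \<open>finite V\<close> branch_subset[THEN subsetD] i(1) finF weight in \<open>auto simp: F\<close>)
    then show ?thesis using i(1) finF by (simp add: n_def)
  next
    case False
    define E where "E = {j \<in> F. \<not> up i j}"
    have finE: "finite E" "E \<noteq> {}" using finF False by (auto simp: E_def)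
    define h where "h = Max E"
    have h: "h \<in> E" "\<And>j. j \<in> E \<Longrightarrow> j \<le> h" using finE by (auto simp: h_def)
    have hF: "h \<in> F" "\<not> up i h" using h(1) by (auto simp: E_def)
    have hi: "\<not> up h i" using up_le[of h i] i(2)[OF hF(1)] hF(2) by (metis le_antisym up_refl)
    have disj: "branch V \<pi> i \<inter> branch V \<pi> h = {}"
      using up_linear hi hF(2) by (auto simp: branch_def)
    have out: "\<not> up j i \<and> \<not> up j h" if "j \<in> insert 0 (F - {i, h})" for j
    proof (cases "j = 0")
      case True
      then show ?thesis using up_le[of 0 i] up_le[of 0 h] i(1) hF(1) by (auto simp: F)
    next
      case False
      then have j: "j \<in> F" "j \<noteq> i" "j \<noteq> h" using that by auto
      have "\<not> up j i" using up_le[of j i] i(2)[of j] j by auto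
      moreover have "\<not> up j h"
      proof
        assume "up j h"
        then have "h < j" using up_le[of j h] j by auto
        then have "up i j" using h(2)[of j] j by (auto simp: E_def)
        then show False using \<open>up j h\<close> hF(2) up_trans by blast
      qed
      ultimately show ?thesis by simp
    qed
    have "2 * t + card (insert 0 (F - {i, h})) * D \<le> card V"
    proof (rule card_two_parts_and_fibres[where \<pi> = \<pi>])
      show "branch V \<pi> i \<inter> branch V \<pi> h = {}" by (fact disj)
      show "v \<notin> branch V \<pi> i \<and> v \<notin> branch V \<pi> h" if "v \<in> V" "\<pi> v \<in> insert 0 (F - {i, h})" for v
        using out[of "\<pi> v"] that by (simp add: branch_def)
    qed (use \<open>finite V\<close> branch_subset[THEN subsetD] i(1) hF(1) finF weight \<open>0 < m\<close> in \<open>auto simp: F\<close>)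
    moreover have "card (insert 0 (F - {i, h})) = card F - 1"
    proof -
      have "i \<noteq> h" using hF(2) by auto
      have "0 \<notin> F" by (auto simp: F)
      then have "card (insert 0 (F - {i, h})) = Suc (card (F - {i, h}))" using finF by simp
      also have "card (F - {i, h}) = card F - 2"
        using i(1) hF(1) \<open>i \<noteq> h\<close> finF by (simp add: card_Diff_subset)
      also have "Suc (card F - 2) = card F - 1"
        using card_mono[OF finF, of "{i, h}"] i(1) hF(1) \<open>i \<noteq> h\<close> by simp
      finally show ?thesis .
    qed
    ultimately show ?thesis by (simp add: n_def)
  qed
qed

end

section \<open>Counting the sets that an edge separates\<close>

definition split_count :: "nat \<Rightarrow> nat \<Rightarrow> nat \<Rightarrow> real" where
  "split_count n k a = real (n choose k) - real (a choose k) - real ((n - a) choose k)"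

lemma card_split_sets:
  assumes "finite V" "B \<subseteq> V" "k \<ge> 1"
  shows "real (card {S. S \<subseteq> V \<and> card S = k \<and> S \<inter> B \<noteq> {} \<and> \<not> S \<subseteq> B}) = split_count (card V) k (card B)"
proof -
  let ?P = "\<lambda>A. {S. S \<subseteq> A \<and> card S = k}"
  let ?X = "{S. S \<subseteq> V \<and> card S = k \<and> S \<inter> B \<noteq> {} \<and> \<not> S \<subseteq> B}"
  have fin: "finite (?P V)" using assms(1) by (auto intro: finite_subset[of _ "Pow V"])
  have sub: "?P B \<subseteq> ?P V" "?P (V - B) \<subseteq> ?P V" "?X \<subseteq> ?P V" using assms(2) by auto
  have "?P V = ?X \<union> (?P B \<union> ?P (V - B))" using assms(2) by auto
  moreover have "?P B \<inter> ?P (V - B) = {}"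
  proof -
    have "S = {}" if "S \<subseteq> B" "S \<subseteq> V - B" for S using that by auto
    moreover have "card ({} :: 'a set) \<noteq> k" using assms(3) by simp
    ultimately show ?thesis by blast
  qed
  moreover have "?X \<inter> (?P B \<union> ?P (V - B)) = {}" by auto
  moreover have "finite ?X" "finite (?P B)" "finite (?P (V - B))"
    using finite_subset[OF sub(1) fin] finite_subset[OF sub(2) fin] finite_subset[OF sub(3) fin]
    by simp_all
  ultimately have "card (?P V) = card ?X + (card (?P B) + card (?P (V - B)))"
    by (simp only: card_Un_disjoint finite_Un)
  moreover have "finite B" using assms finite_subset by auto
  ultimately show ?thesis
    using assms by (simp add: n_subsets split_count_def card_Diff_subset)
qed

text \<open>By the Pascal rule, this is the increment \<open>split_count n k t - split_count n k (t - 1)\<close> for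
  \<open>1 \<le> t \<le> n\<close>.\<close>

definition split_step :: "nat \<Rightarrow> nat \<Rightarrow> nat \<Rightarrow> real" where
  "split_step n k t = real ((n - t) choose (k - 1)) - real ((t - 1) choose (k - 1))"

lemma split_step_nonneg: "2 * t \<le> n \<Longrightarrow> 0 \<le> split_step n k t"
  unfolding split_step_def using binomial_right_mono[of "t - 1" "n - t" "k - 1"] by simp

lemma split_count_eq_sum_steps:
  assumes "k \<ge> 1" "a \<le> n"
  shows "split_count n k a = (\<Sum>t=1..a. split_step n k t)"
  using assms(2)
proof (induction a)
  case 0
  then show ?case using assms(1) by (simp add: split_count_def binomial_eq_0)
next
  case (Suc a)
  obtain j where k: "k = Suc j" using assms(1) by (cases k) auto
  have "split_count n k (Suc a) = split_count n k a + split_step n k (Suc a)"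
    using Suc.prems by (simp add: split_count_def split_step_def k Suc_diff_Suc[symmetric, of a n])
  then show ?case using Suc by simp
qed

lemma split_count_min: "a \<le> n \<Longrightarrow> split_count n k a = split_count n k (min a (n - a))"
  by (auto simp: split_count_def min_def)

text \<open>The closed forms of \<open>\<Sum>u<n. u choose j\<close> and \<open>\<Sum>u<n. u * (u choose j)\<close> combine to this.\<close>

lemma sum_weighted_binomial:
  "real (j + 2) * (\<Sum>u<n. real (u choose j) * (2 * real u + 1 - real n))
    = real j * (real n + 1) * real (n choose (j + 1))"
proof -
  have A: "(\<Sum>u<n. real (u choose j)) = real (n choose (j + 1))"
    by (induction n) auto
  have B: "(\<Sum>u<n. real u * real (u choose j))
      = real (j + 1) * real ((n + 1) choose (j + 2)) - real (n choose (j + 1))"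
  proof (induction n)
    case (Suc n)
    have "real (Suc j * (Suc n choose Suc j)) = real (Suc n * (n choose j))"
      using Suc_times_binomial_eq[of n j] by (simp only: mult.commute)
    then have "real (j + 1) * real ((n + 1) choose (j + 1)) = real (n + 1) * real (n choose j)"
      unfolding of_nat_mult by (simp del: binomial_Suc_Suc)
    then show ?case using Suc by (simp add: algebra_simps)
  qed simp
  have "Suc (Suc j) * (Suc n choose Suc (Suc j)) = Suc n * (n choose Suc j)"
    using Suc_times_binomial_eq[of n "Suc j"] by (simp only: mult.commute)
  then have "real (Suc (Suc j) * (Suc n choose Suc (Suc j))) = real (Suc n * (n choose Suc j))"
    by (simp only:)
  then have C: "real (j + 2) * real ((n + 1) choose (j + 2)) = real (n + 1) * real (n choose (j + 1))"
    unfolding of_nat_mult by (simp del: binomial_Suc_Suc)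
  have "(\<Sum>u<n. real (u choose j) * (2 * real u + 1 - real n))
     = 2 * (\<Sum>u<n. real u * real (u choose j)) + (1 - real n) * (\<Sum>u<n. real (u choose j))"
    unfolding sum_distrib_left sum.distrib[symmetric] by (intro sum.cong) (auto simp: algebra_simps)
  also have "real (j + 2) * \<dots> = 2 * real (j + 1) * (real (j + 2) * real ((n + 1) choose (j + 2)))
      + real (j + 2) * (- 1 - real n) * real (n choose (j + 1))"
    unfolding A B by (simp add: algebra_simps)
  also have "\<dots> = real j * (real n + 1) * real (n choose (j + 1))"
    unfolding C by (simp add: algebra_simps)
  finally show ?thesis .
qed

text \<open>This is the Steiner \<open>k\<close>-Wiener index of a path on \<open>n\<close> vertices: \<open>n + 1 - 2 * t\<close> of its edges have at
  least \<open>t\<close> vertices on both sides. To evaluate it, note that the increments are odd about the middle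
  of \<open>{1..n}\<close>, and so is the factor \<open>n + 1 - 2 * t\<close>; hence the sum over the first half is half of the
  sum over all of \<open>{1..n}\<close>, and the two binomial coefficients in \<open>split_step\<close> contribute equally to
  the latter.\<close>

lemma sum_split_step_path:
  assumes "k \<ge> 1"
  shows "(\<Sum>t=1..n div 2. split_step n k t * (real n + 1 - 2 * real t))
    = (real k - 1) / (real k + 1) * (real n + 1) * real (n choose k)"
proof -
  obtain j where k: "k = Suc j" using assms by (cases k) auto
  let ?g = "\<lambda>t. split_step n k t * (real n + 1 - 2 * real t)"
  let ?c = "\<lambda>t. real ((n - t) choose j) * (real n + 1 - 2 * real t)"
  let ?h = "n div 2"
  have refl: "(\<Sum>t\<in>{1..n}. f (n + 1 - t)) = (\<Sum>t\<in>{1..n}. f t)" for f :: "nat \<Rightarrow> real"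
    by (rule sum.reindex_bij_witness[of _ "\<lambda>t. n + 1 - t" "\<lambda>t. n + 1 - t"]) auto
  have g_sym: "?g (n + 1 - t) = ?g t" if "t \<in> {1..n}" for t
    using that by (auto simp: split_step_def of_nat_diff algebra_simps)
  have c_sym: "?c (n + 1 - t) = - (real ((t - 1) choose j) * (real n + 1 - 2 * real t))"
    if "t \<in> {1..n}" for t
  proof -
    have "n - (n + 1 - t) = t - 1" "real (n + 1 - t) = real n + 1 - real t" using that by (auto simp: of_nat_diff)
    then show ?thesis by (simp add: algebra_simps)
  qed
  have half: "(\<Sum>t\<in>{1..n}. ?g t) = 2 * (\<Sum>t\<in>{1..?h}. ?g t)"
  proof -
    have mid: "(\<Sum>t\<in>{?h+1..n - ?h}. ?g t) = 0"
    proof (rule sum.neutral, rule ballI)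
      fix t assume "t \<in> {?h+1..n - ?h}"
      then have "n + 1 = 2 * t" by (simp, presburger)
      then have "real n + 1 - 2 * real t = 0" by linarith
      then show "?g t = 0" by simp
    qed
    have top: "(\<Sum>t\<in>{n - ?h + 1..n}. ?g t) = (\<Sum>t\<in>{1..?h}. ?g t)"
      by (rule sum.reindex_bij_witness[of _ "\<lambda>t. n + 1 - t" "\<lambda>t. n + 1 - t"])
        (use g_sym in \<open>auto simp del: of_nat_diff\<close>)
    have parts: "{1..n} = ({1..?h} \<union> {?h+1..n - ?h}) \<union> {n - ?h + 1..n}" by (auto, presburger?)
    have "(\<Sum>t\<in>{1..n}. ?g t) = (\<Sum>t\<in>{1..?h} \<union> {?h+1..n - ?h}. ?g t) + (\<Sum>t\<in>{n - ?h + 1..n}. ?g t)"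
      unfolding parts by (rule sum.union_disjoint) auto
    also have "(\<Sum>t\<in>{1..?h} \<union> {?h+1..n - ?h}. ?g t) = (\<Sum>t\<in>{1..?h}. ?g t) + (\<Sum>t\<in>{?h+1..n - ?h}. ?g t)"
      by (rule sum.union_disjoint) auto
    finally show ?thesis using mid top by simp
  qed
  have "(\<Sum>t\<in>{1..n}. ?g t) = (\<Sum>t\<in>{1..n}. ?c t + ?c (n + 1 - t))"
    using c_sym by (intro sum.cong) (auto simp: split_step_def k algebra_simps)
  also have "\<dots> = 2 * (\<Sum>t\<in>{1..n}. ?c t)"
    unfolding sum.distrib refl[of ?c] by simp
  also have "(\<Sum>t\<in>{1..n}. ?c t) = (\<Sum>u<n. real (u choose j) * (2 * real u + 1 - real n))"
    by (rule sum.reindex_bij_witness[of _ "\<lambda>u. n - u" "\<lambda>t. n - t"])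
      (auto simp: of_nat_diff algebra_simps)
  finally have "(\<Sum>t\<in>{1..?h}. ?g t) = (\<Sum>u<n. real (u choose j) * (2 * real u + 1 - real n))"
    using half by simp
  then show ?thesis using sum_weighted_binomial[of j n] by (simp add: k field_simps)
qed

section \<open>Average size of a Steiner tree in a weighted tree\<close>

context rooted_nat
begin

text \<open>Since the increments are nonnegative up to \<open>n div 2\<close>, only the number of edges whose smaller side
  has weight at least \<open>t\<close> matters, for every \<open>t\<close>. That number is at most \<open>(n - 2 * t) / D + 1\<close>, which
  is \<open>1 / D\<close> times the number \<open>n + 1 - 2 * t\<close> of such edges in a path on \<open>n\<close> vertices, plus
  \<open>1 - 1 / D\<close>.\<close>

lemma sum_split_count_branches_le:
  fixes V :: "'a set" and \<pi> :: "'a \<Rightarrow> nat"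
  defines "n \<equiv> card V"
  assumes "finite V" "0 < m" "0 < D" "k \<ge> 1"
    and weight: "\<And>i. i < m \<Longrightarrow> D \<le> card {v \<in> V. \<pi> v = i}"
  shows "(\<Sum>i=1..<m. split_count n k (card (branch V \<pi> i)))
    \<le> (real k - 1) / (real k + 1) * ((real n + 1) / real D) * real (n choose k)
      + (1 - 1 / real D) * real (n choose k)"
proof -
  let ?h = "n div 2"
  define a where "a i = card (branch V \<pi> i)" for i
  define s where "s i = min (a i) (n - a i)" for i
  let ?N = "\<lambda>t. card {i \<in> {1..<m}. t \<le> s i}"
  have an: "a i \<le> n" for i
    using \<open>finite V\<close> branch_subset[of V \<pi> i] by (simp add: a_def n_def card_mono)
  have sh: "s i \<le> ?h" for i by (auto simp: s_def min_def)
  have steps: "split_count n k (a i) = (\<Sum>t=1..s i. split_step n k t)" for i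
    using split_count_min[OF an, of k i] split_count_eq_sum_steps[OF \<open>k \<ge> 1\<close>, of "s i" n] an[of i]
    by (simp add: s_def)
  have "(\<Sum>i=1..<m. split_count n k (a i)) = (\<Sum>i=1..<m. \<Sum>t=1..s i. split_step n k t)"
    unfolding steps ..
  also have "\<dots> = (\<Sum>i=1..<m. \<Sum>t=1..?h. if t \<le> s i then split_step n k t else 0)"
    using sh by (intro sum.cong refl sum.mono_neutral_cong_left) (auto intro: order_trans)
  also have "\<dots> = (\<Sum>t=1..?h. \<Sum>i=1..<m. if t \<le> s i then split_step n k t else 0)"
    by (rule sum.swap)
  also have "\<dots> = (\<Sum>t=1..?h. split_step n k t * real (?N t))"
    by (intro sum.cong refl) (simp add: sum.inter_filter[symmetric] mult.commute)
  also have "\<dots> \<le> (\<Sum>t=1..?h. split_step n k t * ((real n - 2 * real t) / real D + 1))"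
  proof (rule sum_mono)
    fix t assume t: "t \<in> {1..?h}"
    have t2: "2 * t \<le> n" using t by auto
    have "real (?N t) \<le> (real n - 2 * real t) / real D + 1"
    proof (cases "{i \<in> {1..<m}. t \<le> s i} = {}")
      case True
      have "?N t = 0" unfolding True by simp
      moreover have "0 \<le> (real n - 2 * real t) / real D"
        using t2 by (intro divide_nonneg_nonneg) linarith+
      ultimately show ?thesis by linarith
    next
      case False
      have "{i \<in> {1..<m}. t \<le> s i} = {i. 0 < i \<and> i < m \<and> t \<le> card (branch V \<pi> i) \<and> t \<le> n - card (branch V \<pi> i)}"
        by (auto simp: s_def a_def)
      then have "2 * t + (?N t - 1) * D \<le> n"
        using card_heavy_edges[OF \<open>finite V\<close> \<open>0 < m\<close> weight] False unfolding n_def by simp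
      then have "real (2 * t + (?N t - 1) * D) \<le> real n" by (simp only: of_nat_le_iff)
      moreover have "1 \<le> ?N t" using False by (simp add: Suc_le_eq card_gt_0_iff)
      ultimately show ?thesis using \<open>0 < D\<close> by (simp add: of_nat_diff field_simps)
    qed
    then show "split_step n k t * real (?N t)
        \<le> split_step n k t * ((real n - 2 * real t) / real D + 1)"
      using split_step_nonneg[OF t2] by (rule mult_left_mono)
  qed
  also have "\<dots> = (\<Sum>t=1..?h. 1 / real D * (split_step n k t * (real n + 1 - 2 * real t))
      + (1 - 1 / real D) * split_step n k t)"
    using \<open>0 < D\<close> by (intro sum.cong refl) (simp add: field_simps)
  also have "\<dots> = 1 / real D * ((real k - 1) / (real k + 1) * (real n + 1) * real (n choose k))
      + (1 - 1 / real D) * split_count n k ?h"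
    using \<open>k \<ge> 1\<close> sum_split_step_path[of k n] split_count_eq_sum_steps[of k ?h n]
    by (simp add: sum.distrib sum_distrib_left[symmetric] del: times_divide_eq_left)
  also have "\<dots> \<le> 1 / real D * ((real k - 1) / (real k + 1) * (real n + 1) * real (n choose k))
      + (1 - 1 / real D) * real (n choose k)"
    using \<open>0 < D\<close> by (intro add_left_mono mult_left_mono) (auto simp: split_count_def)
  finally show ?thesis unfolding a_def by (simp add: mult.commute)
qed

text \<open>The edges, each named by its lower end, of the smallest subtree that contains the positions of
  all points of \<open>S\<close>.\<close>

definition crossed :: "nat \<Rightarrow> 'a set \<Rightarrow> ('a \<Rightarrow> nat) \<Rightarrow> 'a set \<Rightarrow> nat set" where
  "crossed m V \<pi> S =
     {i \<in> {1..<m}. S \<inter> branch V \<pi> i \<noteq> {} \<and> \<not> S \<subseteq> branch V \<pi> i}"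

lemma sum_card_crossed:
  assumes "finite V" "k \<ge> 1"
  shows "(\<Sum>S | S \<subseteq> V \<and> card S = k. real (card (crossed m V \<pi> S)))
    = (\<Sum>i=1..<m. split_count (card V) k (card (branch V \<pi> i)))"
proof -
  let ?P = "{S. S \<subseteq> V \<and> card S = k}"
  have fin: "finite ?P" using assms(1) by (auto intro: finite_subset[of _ "Pow V"])
  have "(\<Sum>S\<in>?P. real (card (crossed m V \<pi> S)))
      = (\<Sum>S\<in>?P. \<Sum>i=1..<m. if S \<inter> branch V \<pi> i \<noteq> {} \<and> \<not> S \<subseteq> branch V \<pi> i then 1 else 0)"
    unfolding crossed_def by (intro sum.cong refl) (simp add: sum.inter_filter[symmetric])
  also have "\<dots> = (\<Sum>i=1..<m. \<Sum>S\<in>?P. if S \<inter> branch V \<pi> i \<noteq> {} \<and> \<not> S \<subseteq> branch V \<pi> i then 1 else 0)"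
    by (rule sum.swap)
  also have "\<dots> = (\<Sum>i=1..<m. real (card {S \<in> ?P. S \<inter> branch V \<pi> i \<noteq> {} \<and> \<not> S \<subseteq> branch V \<pi> i}))"
    using fin by (intro sum.cong refl) (simp add: sum.inter_filter[symmetric])
  also have "\<dots> = (\<Sum>i=1..<m. split_count (card V) k (card (branch V \<pi> i)))"
    using card_split_sets[OF assms(1) branch_subset assms(2)] by (simp add: conj_assoc)
  finally show ?thesis .
qed

text \<open>The vertex \<open>\<tau>\<close> is the lowest common ancestor of the positions of \<open>S\<close>. As parents have smaller numbers,
  it is the common ancestor with the largest number.\<close>

lemma crossed_apex:
  assumes "S \<subseteq> V" "S \<noteq> {}" and \<pi>: "\<And>v. v \<in> V \<Longrightarrow> \<pi> v < m"
  obtains \<tau> where "\<tau> < m" "\<tau> \<notin> crossed m V \<pi> S"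
    "\<And>v. v \<in> S \<Longrightarrow> \<pi> v \<in> insert \<tau> (crossed m V \<pi> S)"
    "\<And>i. i \<in> crossed m V \<pi> S \<Longrightarrow> par i \<in> insert \<tau> (crossed m V \<pi> S)"
proof -
  define Z where "Z = {i. i < m \<and> S \<subseteq> branch V \<pi> i}"
  have "0 < m" using assms by fastforce
  then have Z: "finite Z" "0 \<in> Z" using assms(1) up_0 by (auto simp: Z_def branch_def)
  define \<tau> where "\<tau> = Max Z"
  have "\<tau> \<in> Z" using Z Max_in unfolding \<tau>_def by blast
  then have \<tau>: "\<tau> < m" "\<And>v. v \<in> S \<Longrightarrow> up (\<pi> v) \<tau>" by (auto simp: Z_def branch_def)
  have above: "i \<le> \<tau>" if "i \<in> Z" for i using that Z(1) by (simp add: \<tau>_def)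
  have crossedI: "i = \<tau> \<or> i \<in> crossed m V \<pi> S" if "i < m" "up i \<tau>" "v \<in> S" "up (\<pi> v) i" for i v
  proof (cases "S \<subseteq> branch V \<pi> i")
    case True
    then show ?thesis using above[of i] up_le[OF that(2)] that(1) by (auto simp: Z_def)
  next
    case False
    have "i \<noteq> 0" using False assms(1) up_0 by (auto simp: branch_def)
    moreover have "v \<in> S \<inter> branch V \<pi> i" using that assms(1) by (auto simp: branch_def)
    ultimately show ?thesis using that(1) False by (auto simp: crossed_def)
  qed
  show thesis
  proof (rule that[of \<tau>])
    show "\<tau> < m" by (fact \<tau>)
    show "\<tau> \<notin> crossed m V \<pi> S" using \<open>\<tau> \<in> Z\<close> by (auto simp: crossed_def Z_def)
    show "\<pi> v \<in> insert \<tau> (crossed m V \<pi> S)" if "v \<in> S" for v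
      using crossedI[of "\<pi> v" v] \<pi>[of v] \<tau>(2) that assms(1) by auto
    show "par i \<in> insert \<tau> (crossed m V \<pi> S)" if crossed: "i \<in> crossed m V \<pi> S" for i
    proof -
      have i: "0 < i" "i < m" "\<not> S \<subseteq> branch V \<pi> i" using crossed by (auto simp: crossed_def)
      obtain v where v: "v \<in> S" "up (\<pi> v) i" using crossed by (auto simp: crossed_def branch_def)
      have "\<not> up \<tau> i"
        using i(3) \<tau>(2) assms(1) up_trans[of _ \<tau> i] by (auto simp: branch_def)
      then have "up i \<tau>" "i \<noteq> \<tau>" using up_linear[OF v(2) \<tau>(2)[OF v(1)]] by auto
      then have "up (par i) \<tau>" by (rule up_step)
      moreover have "up (\<pi> v) (par i)" using v(2) up_par[OF i(1)] by (rule up_trans)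
      ultimately show ?thesis
        using crossedI[of "par i" v] par_less[OF i(1)] i(2) v(1) by auto
    qed
  qed
qed

end

section \<open>Linked double stars\<close>

definition nbrs :: "'a sgraph \<Rightarrow> 'a \<Rightarrow> 'a set" where
  "nbrs G v = {u. {v, u} \<in> edges G}"

lemma nbrs_sym: "u \<in> nbrs G v \<longleftrightarrow> v \<in> nbrs G u"
  by (simp add: nbrs_def insert_commute)

lemma nbrs_subset: "simple_graph G \<Longrightarrow> nbrs G v \<subseteq> verts G"
  by (auto simp: nbrs_def simple_graph_def)

lemma nbrs_irrefl: "simple_graph G \<Longrightarrow> u \<in> nbrs G v \<Longrightarrow> u \<noteq> v"
  by (auto simp: nbrs_def simple_graph_def)

lemma degree_eq_card_nbrs:
  assumes "simple_graph G"
  shows "degree G v = card (nbrs G v)"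
proof -
  have "{e \<in> edges G. v \<in> e} = (\<lambda>u. {v, u}) ` nbrs G v"
  proof (intro equalityI subsetI)
    fix e assume e: "e \<in> {e \<in> edges G. v \<in> e}"
    then have "card e = 2" using assms by (auto simp: simple_graph_def)
    then obtain p q where "e = {p, q}" by (auto simp: card_2_iff)
    then have "e = {v, p} \<or> e = {v, q}" using e by auto
    then show "e \<in> (\<lambda>u. {v, u}) ` nbrs G v" using e by (auto simp: nbrs_def)
  qed (auto simp: nbrs_def)
  moreover have "inj_on (\<lambda>u. {v, u}) (nbrs G v)" by (auto simp: inj_on_def doubleton_eq_iff)
  ultimately show ?thesis by (simp add: degree_def card_image)
qed

lemma min_degree_le_card_nbrs:
  assumes "simple_graph G" "v \<in> verts G"
  shows "min_degree G \<le> card (nbrs G v)"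
  using assms by (simp add: min_degree_def degree_eq_card_nbrs[symmetric] simple_graph_def)

lemma connected_graph_cut:
  assumes "connected_graph G" "R \<subseteq> verts G" "R \<noteq> {}" "R \<noteq> verts G"
  obtains u v where "u \<in> R" "v \<in> verts G - R" "v \<in> nbrs G u"
proof -
  obtain r w where "r \<in> R" "w \<in> verts G - R" using assms(2-4) by blast
  moreover from this obtain xs where "walk G xs" "hd xs = r" "last xs = w"
    using assms(1,2) unfolding connected_graph_def by blast
  moreover have "\<exists>u v. u \<in> R \<and> v \<in> verts G - R \<and> v \<in> nbrs G u"
    if "walk G xs" "hd xs \<in> R" "last xs \<notin> R" for xs
    using that
  proof (induction xs)
    case (Cons z zs)
    have zs: "zs \<noteq> []" using Cons.prems by auto
    then have "walk G zs" "{z, hd zs} \<in> edges G" "hd zs \<in> verts G"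
      using Cons.prems(1) by (cases zs; auto simp: walk_def)+
    then show ?case using Cons zs by (cases "hd zs \<in> R") (auto simp: nbrs_def)
  qed (simp add: walk_def)
  ultimately show thesis using that by blast
qed

text \<open>A sequence of edges \<open>x i y i\<close> whose neighbourhoods are disjoint, each but the first one joined to
  the neighbourhood of an earlier one through the edge \<open>b i a i\<close>; the names of the ends are chosen
  so that \<open>b i\<close> is adjacent to \<open>x i\<close>.\<close>

locale cluster_family =
  fixes G :: "'a sgraph" and m :: nat and x y a b :: "nat \<Rightarrow> 'a"
  assumes simple: "simple_graph G"
    and m_pos: "0 < m"
    and central: "i < m \<Longrightarrow> y i \<in> nbrs G (x i)"
    and disjoint: "\<lbrakk>i < m; j < m; i \<noteq> j\<rbrakk>
      \<Longrightarrow> (nbrs G (x i) \<union> nbrs G (y i)) \<inter> (nbrs G (x j) \<union> nbrs G (y j)) = {}"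
    and b_nbr: "\<lbrakk>0 < i; i < m\<rbrakk> \<Longrightarrow> b i \<in> nbrs G (x i)"
    and a_nbr: "\<lbrakk>0 < i; i < m\<rbrakk> \<Longrightarrow> a i \<in> nbrs G (b i)"
    and a_earlier: "\<lbrakk>0 < i; i < m\<rbrakk> \<Longrightarrow> \<exists>j<i. a i \<in> nbrs G (x j) \<union> nbrs G (y j)"
begin

definition cluster :: "nat \<Rightarrow> 'a set" where
  "cluster i = nbrs G (x i) \<union> nbrs G (y i)"

definition clustered :: "'a set" where
  "clustered = (\<Union>i<m. cluster i)"

definition idx :: "'a \<Rightarrow> nat" where
  "idx v = (THE i. i < m \<and> v \<in> cluster i)"

lemma idx_eq: "i < m \<Longrightarrow> v \<in> cluster i \<Longrightarrow> idx v = i"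
  unfolding idx_def using disjoint by (intro the_equality) (auto simp: cluster_def)

lemma idx_less: "v \<in> clustered \<Longrightarrow> idx v < m"
  using idx_eq by (auto simp: clustered_def)

lemma in_cluster_idx: "v \<in> clustered \<Longrightarrow> v \<in> cluster (idx v)"
  using idx_eq by (auto simp: clustered_def)

lemma clusteredI: "i < m \<Longrightarrow> v \<in> cluster i \<Longrightarrow> v \<in> clustered"
  by (auto simp: clustered_def)

lemma x_cluster: "i < m \<Longrightarrow> x i \<in> cluster i"
  using central[of i] nbrs_sym[of "x i" G "y i"] by (simp add: cluster_def)

lemma y_cluster: "i < m \<Longrightarrow> y i \<in> cluster i"
  using central[of i] by (simp add: cluster_def)

lemma b_cluster: "0 < i \<Longrightarrow> i < m \<Longrightarrow> b i \<in> cluster i"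
  using b_nbr[of i] by (simp add: cluster_def)

lemma cluster_subset: "cluster i \<subseteq> verts G"
  using nbrs_subset[OF simple] by (simp add: cluster_def)

lemma clustered_subset: "clustered \<subseteq> verts G"
  using cluster_subset by (auto simp: clustered_def)

lemma finite_verts: "finite (verts G)"
  using simple by (simp add: simple_graph_def)

lemma a_clustered: "0 < i \<Longrightarrow> i < m \<Longrightarrow> a i \<in> clustered"
  using a_earlier[of i] by (fastforce simp: clustered_def cluster_def)

lemma idx_a_less: "0 < i \<Longrightarrow> i < m \<Longrightarrow> idx (a i) < i"
  using a_earlier[of i] idx_eq[of _ "a i"] unfolding cluster_def by (metis less_trans)

lemma y_ne_x: "i < m \<Longrightarrow> y i \<noteq> x i"
  using central nbrs_irrefl[OF simple] by blast

lemma b_ne_x: "0 < i \<Longrightarrow> i < m \<Longrightarrow> b i \<noteq> x i"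
  using b_nbr nbrs_irrefl[OF simple] by blast

text \<open>Otherwise \<open>a i\<close> would lie in the cluster \<open>i\<close>.\<close>

lemma b_ne_y: "0 < i \<Longrightarrow> i < m \<Longrightarrow> b i \<noteq> y i"
  using a_nbr[of i] idx_a_less[of i] idx_eq[of i "a i"] by (auto simp: cluster_def)

lemma m_le_card: "m \<le> card (verts G)"
proof -
  have "inj_on x {..<m}"
    using idx_eq x_cluster by (metis inj_onI lessThan_iff)
  moreover have "x ` {..<m} \<subseteq> verts G" using x_cluster cluster_subset by blast
  ultimately show ?thesis using card_inj_on_le[of x "{..<m}" "verts G"] finite_verts by simp
qed

lemma extend:
  assumes "w \<in> nbrs G v" "(nbrs G v \<union> nbrs G w) \<inter> clustered = {}"
    "z \<in> nbrs G v" "u \<in> nbrs G z" "u \<in> clustered"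
  shows "cluster_family G (Suc m) (x(m := v)) (y(m := w)) (a(m := u)) (b(m := z))"
proof -
  have "(nbrs G (x i) \<union> nbrs G (y i)) \<inter> (nbrs G v \<union> nbrs G w) = {}" if "i < m" for i
    using assms(2) that by (auto simp: clustered_def cluster_def)
  note D = this this[unfolded Int_commute[of _ "nbrs G v \<union> nbrs G w"]]
  have "\<exists>j<m. u \<in> nbrs G (x j) \<union> nbrs G (y j)"
    using assms(5) by (auto simp: clustered_def cluster_def)
  moreover have "\<exists>j<i. (a(m := u)) i \<in> nbrs G ((x(m := v)) j) \<union> nbrs G ((y(m := w)) j)"
    if i: "0 < i" "i < m" for i
  proof -
    obtain j where "j < i" "a i \<in> nbrs G (x j) \<union> nbrs G (y j)" using a_earlier[OF i] by blast
    then show ?thesis using i by (intro exI[of _ j]) simp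
  qed
  ultimately have early: "\<exists>j<i. (a(m := u)) i \<in> nbrs G ((x(m := v)) j) \<union> nbrs G ((y(m := w)) j)"
    if "0 < i" "i < Suc m" for i
    using that by (cases "i = m") (fastforce, simp)
  show ?thesis
  proof
    show "((nbrs G ((x(m := v)) i) \<union> nbrs G ((y(m := w)) i)) \<inter>
        (nbrs G ((x(m := v)) j) \<union> nbrs G ((y(m := w)) j))) = {}"
      if "i < Suc m" "j < Suc m" "i \<noteq> j" for i j
      using that D[of i] D[of j] disjoint[of i j] by (cases "i = m"; cases "j = m") simp_all
  qed (use simple central b_nbr a_nbr early assms in \<open>auto simp: less_Suc_eq\<close>)
qed

text \<open>Otherwise some edge \<open>v w\<close> leads from distance two to distance three from the clusters. Neither end has
  a neighbour in a cluster, but \<open>v\<close> has a neighbour \<open>z\<close> that does, so \<open>v w\<close> could be added.\<close>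

lemma within_two_if_maximal:
  assumes "connected_graph G"
    and maximal: "\<And>x y a b. \<not> cluster_family G (Suc m) x y a b"
    and "v \<in> verts G"
  shows "\<exists>w\<in>insert v (nbrs G v). w \<in> clustered \<or> nbrs G w \<inter> clustered \<noteq> {}"
proof (rule ccontr)
  define R where "R = {v \<in> verts G. \<exists>w\<in>insert v (nbrs G v). w \<in> clustered \<or> nbrs G w \<inter> clustered \<noteq> {}}"
  assume "\<not> ?thesis"
  then have "v \<notin> R" by (simp add: R_def)
  then have "R \<noteq> verts G" using assms(3) by blast
  moreover have "x 0 \<in> R"
    using x_cluster[OF m_pos] cluster_subset clusteredI[OF m_pos] by (auto simp: R_def)
  moreover have "R \<subseteq> verts G" by (auto simp: R_def)
  ultimately obtain v w where vw: "v \<in> R" "w \<in> verts G - R" "w \<in> nbrs G v"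
    using connected_graph_cut[OF assms(1)] by blast
  have w: "\<not> (\<exists>u\<in>insert w (nbrs G w). u \<in> clustered \<or> nbrs G u \<inter> clustered \<noteq> {})"
    using vw(2) by (simp add: R_def)
  have v: "v \<notin> clustered" "nbrs G v \<inter> clustered = {}"
    using w vw(3) nbrs_sym[of w G v] by blast+
  then obtain z u where "z \<in> nbrs G v" "u \<in> nbrs G z" "u \<in> clustered"
    using vw(1) by (auto simp: R_def)
  moreover have "nbrs G w \<inter> clustered = {}" using w by fast
  ultimately show False using extend[of w v z u] vw(3) v maximal by fast
qed

end

lemma cluster_family_edge:
  assumes "simple_graph G" "w \<in> nbrs G v"
  shows "cluster_family G 1 (\<lambda>_. v) (\<lambda>_. w) (\<lambda>_. v) (\<lambda>_. v)"
  using assms by unfold_locales auto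

section \<open>The spanning tree and its Steiner trees\<close>

text \<open>A family to which no further edge can be added has this property (\<open>within_two_if_maximal\<close>).\<close>

locale near_cluster_family = cluster_family +
  assumes near: "v \<in> verts G
    \<Longrightarrow> \<exists>w\<in>insert v (nbrs G v). w \<in> clustered \<or> nbrs G w \<inter> clustered \<noteq> {}"
begin

definition cluster_par :: "nat \<Rightarrow> nat" where
  "cluster_par i = (if 0 < i \<and> i < m then idx (a i) else 0)"

sublocale rooted_nat cluster_par
  by unfold_locales (simp add: cluster_par_def idx_a_less)

text \<open>The tree is rooted at \<open>x 0\<close>. In each cluster the way up leads through the star centres to
  \<open>x i\<close>, on to \<open>b i\<close>, and then to \<open>a i\<close> in the parent cluster. Thus \<open>b i\<close>, for \<open>i > 0\<close>, is the topmost vertex of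
  its cluster.\<close>

definition vpar :: "'a \<Rightarrow> 'a" where
  "vpar v =
    (if v \<in> clustered then
       if v = x (idx v) then b (idx v)
       else if v = y (idx v) then x (idx v)
       else if 0 < idx v \<and> v = b (idx v) then a (idx v)
       else if v \<in> nbrs G (x (idx v)) then x (idx v)
       else y (idx v)
     else if nbrs G v \<inter> clustered \<noteq> {} then SOME u. u \<in> nbrs G v \<inter> clustered
     else SOME u. u \<in> nbrs G v \<and> nbrs G u \<inter> clustered \<noteq> {})"

text \<open>The rank decreases along \<open>vpar\<close>: within a cluster the order is \<open>b i\<close>, \<open>x i\<close>, \<open>y i\<close>, leaves, and
  earlier clusters have smaller ranks.\<close>

definition rank :: "'a \<Rightarrow> nat" where
  "rank v =
    (if v \<in> clustered then
       4 * idx v +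
         (if v = x (idx v) then 1 else if v = y (idx v) then 2
          else if 0 < idx v \<and> v = b (idx v) then 0 else 3)
     else 4 * m + (if nbrs G v \<inter> clustered \<noteq> {} then 0 else 1))"

lemma rank_clustered: "v \<in> clustered \<Longrightarrow> rank v < 4 * Suc (idx v)"
  by (simp add: rank_def)

lemma rank_x: "i < m \<Longrightarrow> rank (x i) = 4 * i + 1"
  using clusteredI[OF _ x_cluster, of i] idx_eq[OF _ x_cluster, of i] by (simp add: rank_def)

lemma rank_y: "i < m \<Longrightarrow> rank (y i) = 4 * i + 2"
  using clusteredI[OF _ y_cluster, of i] idx_eq[OF _ y_cluster, of i] y_ne_x[of i]
  by (simp add: rank_def)

lemma rank_b: "0 < i \<Longrightarrow> i < m \<Longrightarrow> rank (b i) = 4 * i"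
  using clusteredI[OF _ b_cluster, of i] idx_eq[OF _ b_cluster, of i] b_ne_x[of i] b_ne_y[of i]
  by (simp add: rank_def)

lemma vpar_clustered_cases:
  assumes "v \<in> clustered" "v \<noteq> x 0"
  obtains i where "0 < i" "i < m" "idx v = i" "v = x i" "vpar v = b i"
  | i where "i < m" "idx v = i" "v = y i" "vpar v = x i"
  | i where "0 < i" "i < m" "idx v = i" "v = b i" "vpar v = a i"
  | i where "i < m" "idx v = i" "rank v = 4 * i + 3" "v \<in> nbrs G (vpar v)" "vpar v = x i \<or> vpar v = y i"
proof -
  obtain i where i: "idx v = i" by simp
  have im: "i < m" "v \<in> cluster i" using assms idx_less in_cluster_idx i by auto
  consider "v = x i" | "v \<noteq> x i" "v = y i" | "v \<noteq> x i" "v \<noteq> y i" "0 < i \<and> v = b i"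
    | "v \<noteq> x i" "v \<noteq> y i" "\<not> (0 < i \<and> v = b i)" by blast
  then show thesis
  proof cases
    case 1
    then have "0 < i" using assms(2) by (cases "i = 0") auto
    moreover have "vpar v = b i" using 1 i assms(1) by (simp add: vpar_def)
    ultimately show thesis using 1 i im(1) that(1)[of i] by blast
  next
    case 2
    have "vpar v = x i" using 2 i assms(1) by (simp add: vpar_def)
    then show thesis using 2 i im(1) that(2)[of i] by blast
  next
    case 3
    have "vpar v = a i" using 3 i assms(1) by (simp add: vpar_def)
    then show thesis using 3 i im(1) that(3)[of i] by blast
  next
    case 4
    have "rank v = 4 * i + 3" using 4 i assms(1) by (simp add: rank_def)
    moreover have "v \<in> nbrs G (vpar v) \<and> (vpar v = x i \<or> vpar v = y i)"
      using 4 i im(2) assms(1) by (auto simp: vpar_def cluster_def)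
    ultimately show thesis using i im(1) that(4)[of i] by blast
  qed
qed

lemma vpar_unclustered:
  assumes "v \<in> verts G" "v \<notin> clustered"
  shows "vpar v \<in> nbrs G v"
    and "nbrs G v \<inter> clustered \<noteq> {} \<Longrightarrow> vpar v \<in> clustered"
    and "nbrs G v \<inter> clustered = {} \<Longrightarrow> vpar v \<notin> clustered \<and> nbrs G (vpar v) \<inter> clustered \<noteq> {}"
proof -
  have A: "vpar v \<in> nbrs G v \<inter> clustered" if "nbrs G v \<inter> clustered \<noteq> {}"
  proof -
    have "vpar v = (SOME u. u \<in> nbrs G v \<inter> clustered)" using that assms(2) by (simp add: vpar_def)
    moreover have "\<exists>u. u \<in> nbrs G v \<inter> clustered" using that by blast
    ultimately show ?thesis using someI_ex[of "\<lambda>u. u \<in> nbrs G v \<inter> clustered"] by simp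
  qed
  have B: "vpar v \<in> nbrs G v \<and> nbrs G (vpar v) \<inter> clustered \<noteq> {}" if *: "nbrs G v \<inter> clustered = {}"
  proof -
    have "\<exists>u. u \<in> nbrs G v \<and> nbrs G u \<inter> clustered \<noteq> {}" using near[OF assms(1)] * assms(2) by blast
    moreover have "vpar v = (SOME u. u \<in> nbrs G v \<and> nbrs G u \<inter> clustered \<noteq> {})"
      using * assms(2) by (simp add: vpar_def)
    ultimately show ?thesis using someI_ex[of "\<lambda>u. u \<in> nbrs G v \<and> nbrs G u \<inter> clustered \<noteq> {}"] by simp
  qed
  show "vpar v \<in> nbrs G v" using A B by blast
  show "nbrs G v \<inter> clustered \<noteq> {} \<Longrightarrow> vpar v \<in> clustered" using A by blast
  show "nbrs G v \<inter> clustered = {} \<Longrightarrow> vpar v \<notin> clustered \<and> nbrs G (vpar v) \<inter> clustered \<noteq> {}"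
    using B by blast
qed

lemma vpar_nbr:
  assumes "v \<in> verts G" "v \<noteq> x 0"
  shows "vpar v \<in> nbrs G v"
proof (cases "v \<in> clustered")
  case True
  from this assms(2) show ?thesis
  proof (cases rule: vpar_clustered_cases)
    case (1 i)
    then show ?thesis using b_nbr by simp
  next
    case (2 i)
    then show ?thesis using central[of i] nbrs_sym by metis
  next
    case (3 i)
    then show ?thesis using a_nbr by simp
  next
    case (4 i)
    then show ?thesis using nbrs_sym by metis
  qed
qed (use vpar_unclustered assms in blast)

lemma rank_vpar_less:
  assumes "v \<in> verts G" "v \<noteq> x 0"
  shows "rank (vpar v) < rank v"
proof (cases "v \<in> clustered")
  case True
  from this assms(2) show ?thesis
  proof (cases rule: vpar_clustered_cases)
    case (1 i)
    then show ?thesis using rank_x[of i] rank_b[of i] by simp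
  next
    case (2 i)
    then show ?thesis using rank_x[of i] rank_y[of i] by simp
  next
    case (3 i)
    then show ?thesis
      using rank_clustered[OF a_clustered, of i] rank_b[of i] idx_a_less[of i] by simp
  next
    case (4 i)
    then show ?thesis using rank_x[of i] rank_y[of i] by auto
  qed
next
  case False
  show ?thesis
  proof (cases "nbrs G v \<inter> clustered = {}")
    case True
    then show ?thesis using vpar_unclustered(3)[OF assms(1) False] False by (simp add: rank_def)
  next
    case nonempty: False
    then have "vpar v \<in> clustered" using vpar_unclustered(2)[OF assms(1) False] by blast
    then show ?thesis
      using rank_clustered[of "vpar v"] idx_less[of "vpar v"] False by (simp add: rank_def)
  qed
qed

definition cluster_tree :: "'a sgraph" where
  "cluster_tree = parent_graph vpar (x 0) (verts G)"

lemma vpar_in_verts: "v \<in> verts G \<Longrightarrow> v \<noteq> x 0 \<Longrightarrow> vpar v \<in> verts G"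
  using vpar_nbr nbrs_subset[OF simple] by blast

lemma spanning_tree_cluster_tree: "spanning_tree cluster_tree G"
proof -
  have "x 0 \<in> verts G" using x_cluster[OF m_pos] cluster_subset by blast
  then have "tree cluster_tree" unfolding cluster_tree_def
    using vpar_in_verts rank_vpar_less by (intro tree_parent_graph[where rk = rank] finite_verts) auto
  moreover have "edges cluster_tree \<subseteq> edges G"
    using vpar_nbr by (auto simp: cluster_tree_def edges_parent_graph nbrs_def)
  ultimately show ?thesis
    by (simp add: spanning_tree_def subgraph_def tree_def) (simp add: cluster_tree_def)
qed

text \<open>Two steps towards the clusters reach them from everywhere.\<close>

definition toward :: "'a \<Rightarrow> 'a" where
  "toward v = (if v \<in> clustered then v else vpar v)"

definition home :: "'a \<Rightarrow> nat" where
  "home v = idx (toward (toward v))"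

lemma toward_verts: "v \<in> verts G \<Longrightarrow> toward v \<in> verts G"
  using vpar_in_verts[of v] x_cluster[OF m_pos] clusteredI[OF m_pos] by (auto simp: toward_def)

lemma toward_toward_clustered: "v \<in> verts G \<Longrightarrow> toward (toward v) \<in> clustered"
proof -
  assume v: "v \<in> verts G"
  show ?thesis
  proof (cases "v \<in> clustered")
    case False
    show ?thesis
    proof (cases "nbrs G v \<inter> clustered = {}")
      case True
      have "vpar v \<in> verts G" "vpar v \<notin> clustered" "nbrs G (vpar v) \<inter> clustered \<noteq> {}"
        using toward_verts[OF v] vpar_unclustered(3)[OF v False True] False by (auto simp: toward_def)
      then show ?thesis using vpar_unclustered(2)[of "vpar v"] False by (simp add: toward_def)
    next
      case nonempty: False
      then show ?thesis using vpar_unclustered(2)[OF v False] False by (simp add: toward_def)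
    qed
  qed (simp add: toward_def)
qed

lemma home_less: "v \<in> verts G \<Longrightarrow> home v < m"
  by (simp add: home_def idx_less toward_toward_clustered)

lemma home_clustered: "v \<in> clustered \<Longrightarrow> home v = idx v"
  by (simp add: home_def toward_def)

lemma home_eq_if_in_cluster: "i < m \<Longrightarrow> v \<in> cluster i \<Longrightarrow> home v = i"
  using home_clustered[OF clusteredI] idx_eq by simp

text \<open>Some subtree around \<open>S\<close> has at most four vertices per crossed link, two star centres at the top,
  and three vertices per element of \<open>S\<close>: the element itself and the next two on its way to the clusters.\<close>

lemma steiner_dist_cluster_tree_le:
  assumes "S \<subseteq> verts G" "S \<noteq> {}"
  shows "steiner_dist cluster_tree S \<le> 4 * card (crossed m (verts G) home S) + 1 + 3 * card S"
proof -
  let ?X = "crossed m (verts G) home S"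
  obtain \<tau> where \<tau>: "\<tau> < m" "\<tau> \<notin> ?X"
    and home_in: "\<And>v. v \<in> S \<Longrightarrow> home v \<in> insert \<tau> ?X"
    and par_in: "\<And>i. i \<in> ?X \<Longrightarrow> cluster_par i \<in> insert \<tau> ?X"
    using crossed_apex[OF assms, of home m] home_less by blast
  have X: "0 < i" "i < m" if "i \<in> ?X" for i using that by (auto simp: crossed_def)
  have finX: "finite ?X" by (rule finite_subset[of _ "{..<m}"]) (auto dest: X)
  have finS: "finite S" using assms(1) finite_verts finite_subset by blast
  define W where "W = {x \<tau>, y \<tau>} \<union> (\<Union>i\<in>?X. {x i, y i, b i, a i})
    \<union> (\<Union>v\<in>S. {v, toward v, toward (toward v)})"
  \<comment> \<open>The top of the subtree is \<open>x \<tau>\<close>, unless \<open>W\<close> contains \<open>b \<tau>\<close>, the only vertex of the cluster above it.\<close>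
  define t where "t = (if 0 < \<tau> \<and> b \<tau> \<in> W then b \<tau> else x \<tau>)"
  have finW: "finite W" using finX finS by (simp add: W_def)
  have tW: "t \<in> W" by (auto simp: t_def W_def)
  have SW: "S \<subseteq> W" by (auto simp: W_def)
  have Wverts: "W \<subseteq> verts G"
  proof -
    have "{x \<tau>, y \<tau>} \<subseteq> verts G"
      using x_cluster[OF \<tau>(1)] y_cluster[OF \<tau>(1)] cluster_subset by blast
    moreover have "{x i, y i, b i, a i} \<subseteq> verts G" if "i \<in> ?X" for i
      using x_cluster[of i] y_cluster[of i] b_cluster[of i] a_clustered[of i] X[OF that]
        cluster_subset clustered_subset by blast
    moreover have "{v, toward v, toward (toward v)} \<subseteq> verts G" if "v \<in> S" for v
      using that assms(1) toward_verts by blast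
    ultimately show ?thesis unfolding W_def by blast
  qed
  have idxW: "idx w \<in> insert \<tau> ?X" if w: "w \<in> W" "w \<in> clustered" for w
  proof -
    consider "w \<in> {x \<tau>, y \<tau>}" | i where "i \<in> ?X" "w \<in> {x i, y i, b i}" | i where "i \<in> ?X" "w = a i"
      | v where "v \<in> S" "w \<in> {v, toward v, toward (toward v)}"
      using w(1) unfolding W_def by blast
    then show ?thesis
    proof cases
      case 1
      then show ?thesis using idx_eq[OF \<tau>(1)] x_cluster[OF \<tau>(1)] y_cluster[OF \<tau>(1)] by auto
    next
      case (2 i)
      then have "idx w = i"
        using idx_eq[of i] x_cluster[of i] y_cluster[of i] b_cluster[of i] X[of i] by auto
      then show ?thesis using 2 by simp
    next
      case (3 i)
      then show ?thesis using par_in[of i] X[of i] by (simp add: cluster_par_def)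
    next
      case (4 v)
      then have "w = toward (toward v)" using w(2) by (auto simp: toward_def)
      then show ?thesis using home_in[OF 4(1)] by (simp add: home_def)
    qed
  qed
  have centres: "x i \<in> W" "y i \<in> W" if "i \<in> insert \<tau> ?X" for i
    using that by (auto simp: W_def)
  have root: "x 0 \<notin> W - {t}"
  proof
    assume x0: "x 0 \<in> W - {t}"
    have "x 0 \<in> clustered" "idx (x 0) = 0"
      using clusteredI[OF m_pos x_cluster] idx_eq[OF m_pos x_cluster] m_pos by auto
    then have "\<tau> = 0" using idxW[of "x 0"] x0 X by auto
    then show False using x0 by (simp add: t_def)
  qed
  have up_closed: "vpar w \<in> W" if w: "w \<in> W" "w \<noteq> t" for w
  proof (cases "w \<in> clustered")
    case True
    have "w \<noteq> x 0" using root w by blast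
    with True show ?thesis
    proof (cases rule: vpar_clustered_cases)
      case (1 i)
      then have i: "i \<in> insert \<tau> ?X" using idxW[OF w(1) True] by simp
      show ?thesis
      proof (cases "i = \<tau>")
        case True
        then show ?thesis using 1 w(2) by (auto simp: t_def split: if_splits)
      next
        case False
        then show ?thesis using 1 i by (auto simp: W_def)
      qed
    next
      case (2 i)
      then show ?thesis using idxW[OF w(1) True] centres by simp
    next
      case (3 i)
      then have "i \<noteq> \<tau>" using w by (auto simp: t_def)
      then have "i \<in> ?X" using 3 idxW[OF w(1) True] by simp
      then show ?thesis using 3 by (auto simp: W_def)
    next
      case (4 i)
      then show ?thesis using idxW[OF w(1) True] centres by auto
    qed
  next
    case False
    then have "\<exists>v\<in>S. w = v \<or> w = toward v"
    proof -
      have "w \<notin> {x i, y i}" if "i < m" for i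
        using False clusteredI[OF that] x_cluster[OF that] y_cluster[OF that] by auto
      moreover have "w \<notin> {b i, a i}" if "i \<in> ?X" for i
        using False clusteredI[of i "b i"] b_cluster[of i] a_clustered[of i] X[OF that] by auto
      moreover have "w \<noteq> toward (toward v)" if "v \<in> S" for v
        using False toward_toward_clustered[of v] that assms(1) by auto
      ultimately show ?thesis using w(1) X(2) \<tau>(1) unfolding W_def by blast
    qed
    then obtain v where "v \<in> S" "vpar w \<in> {toward v, toward (toward v)}"
      using False by (auto simp: toward_def)
    then show ?thesis unfolding W_def by blast
  qed
  have "steiner_dist cluster_tree S \<le> card W - 1"
    unfolding cluster_tree_def
  proof (rule steiner_dist_parent_graph_le[OF finW tW Wverts SW root])
    show "vpar w \<in> W \<and> rank (vpar w) < rank w" if "w \<in> W" "w \<noteq> t" for w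
      using up_closed that rank_vpar_less[of w] Wverts root by blast
  qed
  moreover have "card W \<le> 2 + 4 * card ?X + 3 * card S"
  proof -
    have "card (\<Union>i\<in>?X. {x i, y i, b i, a i}) \<le> (\<Sum>i\<in>?X. card {x i, y i, b i, a i})"
      using finX by (rule card_UN_le)
    also have "\<dots> \<le> (\<Sum>i\<in>?X. 4)"
      by (intro sum_mono) (auto simp: card_insert_if)
    finally have 1: "card (\<Union>i\<in>?X. {x i, y i, b i, a i}) \<le> 4 * card ?X" by simp
    have "card (\<Union>v\<in>S. {v, toward v, toward (toward v)}) \<le> (\<Sum>v\<in>S. card {v, toward v, toward (toward v)})"
      using finS by (rule card_UN_le)
    also have "\<dots> \<le> (\<Sum>v\<in>S. 3)"
      by (intro sum_mono) (auto simp: card_insert_if)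
    finally have 2: "card (\<Union>v\<in>S. {v, toward v, toward (toward v)}) \<le> 3 * card S" by simp
    have 3: "card {x \<tau>, y \<tau>} \<le> 2" by (auto simp: card_insert_if)
    show ?thesis
      unfolding W_def
      using card_Un_le[of "{x \<tau>, y \<tau>} \<union> (\<Union>i\<in>?X. {x i, y i, b i, a i})"
          "\<Union>v\<in>S. {v, toward v, toward (toward v)}"]
        card_Un_le[of "{x \<tau>, y \<tau>}" "\<Union>i\<in>?X. {x i, y i, b i, a i}"] 1 2 3
      by linarith
  qed
  ultimately show ?thesis by linarith
qed

text \<open>Adjacent vertices of a triangle-free graph have disjoint neighbourhoods, so a double star has at
  least \<open>2 * \<delta>\<close> vertices.\<close>

lemma card_home_fibre:
  assumes "triangle_free G" "i < m"
  shows "2 * min_degree G \<le> card {v \<in> verts G. home v = i}"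
proof -
  have "nbrs G (x i) \<inter> nbrs G (y i) = {}"
    using assms central[of i] unfolding triangle_free_def nbrs_def
    by (auto simp: insert_commute)
  then have "card (cluster i) = card (nbrs G (x i)) + card (nbrs G (y i))"
    unfolding cluster_def
    using nbrs_subset[OF simple] finite_verts finite_subset by (intro card_Un_disjoint) blast+
  moreover have "x i \<in> verts G" "y i \<in> verts G"
    using x_cluster[OF assms(2)] y_cluster[OF assms(2)] cluster_subset by blast+
  ultimately have "2 * min_degree G \<le> card (cluster i)"
    using min_degree_le_card_nbrs[OF simple, of "x i"] min_degree_le_card_nbrs[OF simple, of "y i"]
    by simp
  also have "\<dots> \<le> card {v \<in> verts G. home v = i}"
    using finite_verts cluster_subset home_eq_if_in_cluster[OF assms(2)] by (intro card_mono) auto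
  finally show ?thesis .
qed

lemma steiner_wiener_cluster_tree_le:
  assumes "triangle_free G" "k \<ge> 1" "0 < min_degree G"
  defines "n \<equiv> card (verts G)" and "\<delta> \<equiv> min_degree G"
  shows "real (steiner_wiener k cluster_tree)
    \<le> (real k - 1) / (real k + 1) * (2 * (real n + 1) / real \<delta>) * real (n choose k)
      + ((4 * real \<delta> - 2) / real \<delta> + 3 * real k + 1) * real (n choose k)"
proof -
  let ?P = "{S. S \<subseteq> verts G \<and> card S = k}"
  let ?K = "real (n choose k)"
  have "real (steiner_wiener k cluster_tree) = (\<Sum>S\<in>?P. real (steiner_dist cluster_tree S))"
    by (simp add: steiner_wiener_def cluster_tree_def)
  also have "\<dots> \<le> (\<Sum>S\<in>?P. 4 * real (card (crossed m (verts G) home S)) + (1 + 3 * real k))"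
  proof (rule sum_mono)
    fix S assume S: "S \<in> ?P"
    then have "S \<noteq> {}" using assms(2) by auto
    then have "steiner_dist cluster_tree S \<le> 4 * card (crossed m (verts G) home S) + 1 + 3 * card S"
      using S by (intro steiner_dist_cluster_tree_le) auto
    then have "real (steiner_dist cluster_tree S)
        \<le> real (4 * card (crossed m (verts G) home S) + 1 + 3 * card S)"
      by (rule of_nat_mono)
    then show "real (steiner_dist cluster_tree S) \<le> 4 * real (card (crossed m (verts G) home S)) + (1 + 3 * real k)"
      using S by simp
  qed
  also have "\<dots> = 4 * (\<Sum>i=1..<m. split_count n k (card (branch (verts G) home i))) + (1 + 3 * real k) * ?K"
    using sum_card_crossed[OF finite_verts assms(2), of m home]
    by (simp add: sum.distrib sum_distrib_left[symmetric] n_subsets[OF finite_verts] n_def)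
  also have "\<dots> \<le> 4 * ((real k - 1) / (real k + 1) * ((real n + 1) / real (2 * \<delta>)) * ?K
      + (1 - 1 / real (2 * \<delta>)) * ?K) + (1 + 3 * real k) * ?K"
    unfolding n_def \<delta>_def
    using sum_split_count_branches_le[OF finite_verts m_pos _ assms(2) card_home_fibre[OF assms(1)]]
      assms(3) by (intro add_right_mono mult_left_mono) auto
  also have "\<dots> = (real k - 1) / (real k + 1) * (2 * (real n + 1) / real \<delta>) * ?K
      + ((4 * real \<delta> - 2) / real \<delta> + 3 * real k + 1) * ?K"
  proof -
    have "4 * (1 - 1 / real (2 * \<delta>)) = (4 * real \<delta> - 2) / real \<delta>"
      and "4 * ((real n + 1) / real (2 * \<delta>)) = 2 * (real n + 1) / real \<delta>"
      using assms(3) by (simp_all add: \<delta>_def field_simps)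
    note scaled = this[symmetric]
    show ?thesis unfolding scaled by (simp only: algebra_simps)
  qed
  finally show ?thesis .
qed

end

section \<open>Existence of the spanning tree\<close>

text \<open>The number of clusters is bounded by the number of vertices, so a largest family exists.\<close>

lemma exists_near_cluster_family:
  assumes "simple_graph G" "connected_graph G" "0 < min_degree G"
  obtains m x y a b where "near_cluster_family G m x y a b"
proof -
  let ?C = "\<lambda>m. \<exists>x y a b. cluster_family G m x y a b"
  obtain v where "v \<in> verts G" using assms(2) by (auto simp: connected_graph_def)
  then have "nbrs G v \<noteq> {}" using min_degree_le_card_nbrs[OF assms(1)] assms(3) by fastforce
  then have "?C 1" using cluster_family_edge[OF assms(1)] by blast
  moreover have bound: "\<forall>m. ?C m \<longrightarrow> m \<le> card (verts G)" using cluster_family.m_le_card by blast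
  ultimately have "?C (Greatest ?C)" using GreatestI_nat[of ?C 1 "card (verts G)"] by blast
  then obtain x y a b where "cluster_family G (Greatest ?C) x y a b" by blast
  then interpret cluster_family G "Greatest ?C" x y a b .
  have "\<not> cluster_family G (Suc (Greatest ?C)) x' y' a' b'" for x' y' a' b'
    using Greatest_le_nat[of ?C "Suc (Greatest ?C)"] bound Suc_n_not_le_n by blast
  then have "near_cluster_family G (Greatest ?C) x y a b"
    using within_two_if_maximal[OF assms(2)] by unfold_locales blast
  then show thesis by (rule that)
qed

lemma trivial_graph_if_isolated_vertex:
  assumes "simple_graph G" "connected_graph G" "min_degree G = 0"
  obtains v where "verts G = {v}" "edges G = {}"
proof -
  have fin: "finite (verts G)" "verts G \<noteq> {}"
    using assms by (auto simp: simple_graph_def connected_graph_def)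
  then have "Min (degree G ` verts G) \<in> degree G ` verts G" by (intro Min_in) auto
  then have "0 \<in> degree G ` verts G" using assms(3) by (simp add: min_degree_def)
  then obtain v where v: "v \<in> verts G" "card (nbrs G v) = 0"
    using degree_eq_card_nbrs[OF assms(1)] by auto
  then have "nbrs G v = {}" using nbrs_subset[OF assms(1)] fin(1) finite_subset by fastforce
  then have "{v} = verts G"
    using connected_graph_cut[OF assms(2), of "{v}"] v(1) by blast
  then have "verts G = {v}" ..
  moreover have "edges G = {}"
  proof -
    have "False" if "e \<in> edges G" for e
    proof -
      have "card e = 2" "e \<subseteq> {v}"
        using that assms(1) \<open>verts G = {v}\<close> by (auto simp: simple_graph_def)
      then show False using card_mono[of "{v}" e] by simp
    qed
    then show ?thesis by blast
  qed
  ultimately show thesis by (rule that)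
qed

theorem theorem4:
  fixes G :: "'a sgraph" and k n \<delta> :: nat
  assumes "k \<ge> 1"
    and "simple_graph G"
    and "connected_graph G"
    and "triangle_free G"
    and "card (verts G) = n"
    and "min_degree G = \<delta>"
  shows "\<exists>T. spanning_tree T G \<and>
    real (steiner_wiener k T)
      \<le> (real k - 1) / (real k + 1) * (2 * (real n + 1) / real \<delta>) * real (n choose k)
        + ((4 * real \<delta> - 2) / real \<delta> + 3 * real k + 1) * real (n choose k)"
proof (cases "\<delta> = 0")
  case True
  then obtain v where v: "verts G = {v}" "edges G = {}"
    using trivial_graph_if_isolated_vertex assms by metis
  have "\<not> cycle G xs" for xs
    using v(2) by (auto simp: cycle_def)
  then have "spanning_tree G G"
    using assms by (simp add: spanning_tree_def tree_def subgraph_def)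
  moreover have "steiner_dist G S = 0" if "S \<subseteq> verts G" for S
    using steiner_dist_le[of G G S] that assms v by (simp add: subgraph_def)
  then have "steiner_wiener k G = 0" by (simp add: steiner_wiener_def)
  \<comment> \<open>Division by zero yields zero, so only nonnegative terms are left on the right.\<close>
  ultimately show ?thesis using True by (intro exI[of _ G]) simp
next
  case False
  then obtain m x y a b where "near_cluster_family G m x y a b"
    using exists_near_cluster_family assms by (metis gr0I)
  then interpret near_cluster_family G m x y a b .
  show ?thesis
    using spanning_tree_cluster_tree steiner_wiener_cluster_tree_le[of k] assms False by auto
qed

end
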